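(* For each of the triplets $(e,12,e)$, $(e,12,13)$, $(e,12,23)$, $(e,13,12)$, $(e,23,e)$, $(e,23,13)$, $(e,23,23)$, $(e,123,e)$, $(e,123,13)$, $(e,123,23)$, the minimal terms of the TRIP-Stern tree lie on both the left-most and the right-most paths: for every $n\ge0$, the minimum $b_n=\min_{|v|=n}\min_i b_i(v)$ is attained as an entry of $(1,1,1)F_0^n$ and also as an entry of $(1,1,1)F_1^n$.
   Context: Let $A_0=\begin{pmatrix}0&0&1\\1&0&0\\0&1&1\end{pmatrix}$, $A_1=\begin{pmatrix}1&0&1\\0&1&0\\0&0&1\end{pmatrix}$. Elements of $S_3$ are identified with permutation matrices: $e=I$, $(12)=\begin{pmatrix}0&1&0\\1&0&0\\0&0&1\end{pmatrix}$, $(13)=\begin{pmatrix}0&0&1\\0&1&0\\1&0&0\end{pmatrix}$, $(23)=\begin{pmatrix}1&0&0\\0&0&1\\0&1&0\end{pmatrix}$, $(123)=\begin{pmatrix}0&1&0\\0&0&1\\1&0&0\end{pmatrix}$, $(132)=\begin{pmatrix}0&0&1\\1&0&0\\0&1&0\end{pmatrix}$. For $(\sigma,\tau_0,\tau_1)\in S_3^3$ put $F_0=\sigma A_0\tau_0$, $F_1=\sigma A_1\tau_1$. For $v=(i_1,\dots,i_n)\in\{0,1\}^n$ let $\triangle(v)=(1,1,1)F_{i_1}\cdots F_{i_n}=(b_1(v),b_2(v),b_3(v))$; level $n$ of the TRIP-Stern tree consists of the $\triangle(v)$ with $|v|=n$. *)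

theory Defs
  imports "HOL-Analysis.Analysis"
begin

definition A0 :: "int^3^3" where
  "A0 = vector [vector [0, 0, 1],
                vector [1, 0, 0],
                vector [0, 1, 1]]"

definition A1 :: "int^3^3" where
  "A1 = vector [vector [1, 0, 1],
                vector [0, 1, 0],
                vector [0, 0, 1]]"

text \<open>The elements of \<open>S\<^sub>3\<close>, identified with permutation matrices: the matrix of
  \<open>\<sigma>\<close> has its unit entries at the positions \<open>(i, \<sigma> i)\<close>.\<close>

definition P_e :: "int^3^3" where
  "P_e = mat 1"

definition P_12 :: "int^3^3" where
  "P_12 = vector [vector [0, 1, 0],
                  vector [1, 0, 0],
                  vector [0, 0, 1]]"

definition P_13 :: "int^3^3" where
  "P_13 = vector [vector [0, 0, 1],
                  vector [0, 1, 0],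
                  vector [1, 0, 0]]"

definition P_23 :: "int^3^3" where
  "P_23 = vector [vector [1, 0, 0],
                  vector [0, 0, 1],
                  vector [0, 1, 0]]"

definition P_123 :: "int^3^3" where
  "P_123 = vector [vector [0, 1, 0],
                   vector [0, 0, 1],
                   vector [1, 0, 0]]"

definition P_132 :: "int^3^3" where
  "P_132 = vector [vector [0, 0, 1],
                   vector [1, 0, 0],
                   vector [0, 1, 0]]"

definition F0 :: "int^3^3 \<Rightarrow> int^3^3 \<Rightarrow> int^3^3" where
  "F0 \<sigma> \<tau>0 = \<sigma> ** A0 ** \<tau>0"

definition F1 :: "int^3^3 \<Rightarrow> int^3^3 \<Rightarrow> int^3^3" where
  "F1 \<sigma> \<tau>1 = \<sigma> ** A1 ** \<tau>1"

definition words :: "nat \<Rightarrow> nat list set" where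
  "words n = {v. length v = n \<and> set v \<subseteq> {0, 1}}"

text \<open>The ordered matrix product \<open>F\<^bsub>i\<^sub>1\<^esub> \<cdots> F\<^bsub>i\<^sub>n\<^esub>\<close>; only words with letters
  \<open>0\<close> and \<open>1\<close> are meaningful.\<close>

fun word_mat :: "int^3^3 \<Rightarrow> int^3^3 \<Rightarrow> nat list \<Rightarrow> int^3^3" where
  "word_mat M0 M1 [] = mat 1"
| "word_mat M0 M1 (i # v) = (if i = 0 then M0 else M1) ** word_mat M0 M1 v"

fun mat_power :: "int^3^3 \<Rightarrow> nat \<Rightarrow> int^3^3" where
  "mat_power M 0 = mat 1"
| "mat_power M (Suc n) = M ** mat_power M n"

definition ones :: "int^3" where
  "ones = vector [1, 1, 1]"

definition triangle :: "int^3^3 \<Rightarrow> int^3^3 \<Rightarrow> int^3^3 \<Rightarrow> nat list \<Rightarrow> int^3" where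
  "triangle \<sigma> \<tau>0 \<tau>1 v = ones v* word_mat (F0 \<sigma> \<tau>0) (F1 \<sigma> \<tau>1) v"

definition level_min :: "int^3^3 \<Rightarrow> int^3^3 \<Rightarrow> int^3^3 \<Rightarrow> nat \<Rightarrow> int" where
  "level_min \<sigma> \<tau>0 \<tau>1 n =
     Min ((\<lambda>v. Min (range (\<lambda>i. triangle \<sigma> \<tau>0 \<tau>1 v $ i))) ` words n)"

end

theory Submission
  imports Defs
begin

text \<open>Every level minimum equals \<open>1\<close>. The maps \<open>v \<mapsto> v F\<^sub>0\<close> and \<open>v \<mapsto> v F\<^sub>1\<close> preserve the vectors with
  all entries at least \<open>1\<close>, and for each of them there is a nonempty set of coordinates that are
  merely copied from coordinates in the same set, so that along the two extreme paths these
  coordinates keep their initial value \<open>1\<close>.\<close>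

lemma row_times_A0: "v v* A0 = vector [v $ 2, v $ 3, v $ 1 + v $ 3]"
  by (simp add: vec_eq_iff forall_3 A0_def vector_matrix_mult_def sum_3)

lemma row_times_A1: "v v* A1 = vector [v $ 1, v $ 2, v $ 1 + v $ 3]"
  by (simp add: vec_eq_iff forall_3 A1_def vector_matrix_mult_def sum_3)

lemma row_times_perm:
  "v v* P_e = v"
  "v v* P_12 = vector [v $ 2, v $ 1, v $ 3]"
  "v v* P_13 = vector [v $ 3, v $ 2, v $ 1]"
  "v v* P_23 = vector [v $ 1, v $ 3, v $ 2]"
  "v v* P_123 = vector [v $ 3, v $ 1, v $ 2]"
  by (simp_all add: vec_eq_iff forall_3 P_e_def P_12_def P_13_def P_23_def P_123_def mat_def
      vector_matrix_mult_def sum_3)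

lemma row_times_F0: "v v* F0 P_e \<tau> = (v v* A0) v* \<tau>"
  by (simp add: F0_def row_times_perm flip: vector_matrix_mul_assoc)

lemma row_times_F1: "v v* F1 P_e \<tau> = (v v* A1) v* \<tau>"
  by (simp add: F1_def row_times_perm flip: vector_matrix_mul_assoc)

text \<open>A row vector meets the first letter of the word first, and the rest of the word then
  acts on the updated vector. Hence the induction runs over arbitrary \<open>v\<close>.\<close>

lemma word_mat_ge_one:
  assumes "\<And>v :: int^3. \<forall>i. 1 \<le> v $ i \<Longrightarrow> \<forall>i. 1 \<le> (v v* M0) $ i"
    and "\<And>v :: int^3. \<forall>i. 1 \<le> v $ i \<Longrightarrow> \<forall>i. 1 \<le> (v v* M1) $ i"
    and "\<forall>i. 1 \<le> v $ i"
  shows "1 \<le> (v v* word_mat M0 M1 w) $ i"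
  using assms(3)
proof (induction w arbitrary: v)
  case Nil
  then show ?case by (simp add: vector_matrix_mul_rid)
next
  case (Cons a w)
  then show ?case using assms(1,2) by (simp flip: vector_matrix_mul_assoc)
qed

text \<open>The invariant concerns a set \<open>K\<close> rather than one index because
  \<open>M\<close> may permute the coordinates in \<open>K\<close>.\<close>

lemma mat_power_fixes_ones:
  assumes "\<And>v :: int^3. \<forall>k\<in>K. v $ k = 1 \<Longrightarrow> \<forall>k\<in>K. (v v* M) $ k = 1"
    and "\<forall>k\<in>K. v $ k = 1" "k \<in> K"
  shows "(v v* mat_power M n) $ k = 1"
  using assms(2)
proof (induction n arbitrary: v)
  case 0
  then show ?case using \<open>k \<in> K\<close> by (simp add: vector_matrix_mul_rid)
next
  case (Suc n)
  then show ?case using assms(1) by (simp flip: vector_matrix_mul_assoc)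
qed

lemma word_mat_replicate:
  "word_mat M0 M1 (replicate n i) = mat_power (if i = 0 then M0 else M1) n"
  by (induction n) auto

lemma finite_words: "finite (words n)"
proof -
  have "words n = {v. set v \<subseteq> {0, 1} \<and> length v = n}"
    by (auto simp: words_def)
  then show ?thesis
    by (simp add: finite_lists_length_eq)
qed

text \<open>The lower bound on all entries and a single entry 1 at \<open>v\<close> squeeze first
  the inner minimum at \<open>v\<close>, then the minimum over the level.\<close>

lemma level_min_eq_one:
  assumes ge: "\<And>v i. 1 \<le> triangle \<sigma> \<tau>0 \<tau>1 v $ i"
    and v: "v \<in> words n" "triangle \<sigma> \<tau>0 \<tau>1 v $ i = 1"
  shows "level_min \<sigma> \<tau>0 \<tau>1 n = 1"
proof -
  let ?m = "\<lambda>v. Min (range (\<lambda>i. triangle \<sigma> \<tau>0 \<tau>1 v $ i))"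
  have m: "1 \<le> ?m v" for v
    using ge by (simp add: Min_ge_iff)
  have "?m v \<le> 1"
    using v(2) by (metis Min_le finite finite_imageI rangeI)
  then have "1 \<in> ?m ` words n"
    using v(1) m by (intro image_eqI[of _ _ v] antisym) auto
  then show ?thesis
    unfolding level_min_def using m by (intro Min_eqI) (auto simp: finite_words)
qed

theorem theorem18:
  fixes \<sigma> \<tau>0 \<tau>1 :: "int^3^3" and n :: nat
  assumes "(\<sigma>, \<tau>0, \<tau>1) \<in>
    {(P_e, P_12, P_e), (P_e, P_12, P_13), (P_e, P_12, P_23), (P_e, P_13, P_12),
     (P_e, P_23, P_e), (P_e, P_23, P_13), (P_e, P_23, P_23),
     (P_e, P_123, P_e), (P_e, P_123, P_13), (P_e, P_123, P_23)}"
  shows "(\<exists>i. level_min \<sigma> \<tau>0 \<tau>1 n = (ones v* mat_power (F0 \<sigma> \<tau>0) n) $ i) \<and>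
         (\<exists>j. level_min \<sigma> \<tau>0 \<tau>1 n = (ones v* mat_power (F1 \<sigma> \<tau>1) n) $ j)"
proof -
  \<comment> \<open>\<open>F0\<close> involves only \<open>\<tau>0\<close> and \<open>F1\<close>
    only \<open>\<tau>1\<close>, so the two ranges can be treated separately.\<close>
  have \<sigma>: "\<sigma> = P_e" and \<tau>0: "\<tau>0 \<in> {P_12, P_13, P_23, P_123}"
    and \<tau>1: "\<tau>1 \<in> {P_e, P_12, P_13, P_23}"
    using assms by auto
  have ones: "ones $ k = 1" for k
    using exhaust_3[of k] by (auto simp: ones_def)
  \<comment> \<open>Each new entry is an old entry or a sum of two old entries.\<close>
  have F0_ge: "\<forall>i. 1 \<le> (v v* F0 \<sigma> \<tau>0) $ i" if "\<forall>i. 1 \<le> v $ i" for v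
    using \<tau>0 that by (auto simp: \<sigma> row_times_F0 row_times_A0 row_times_perm forall_3)
  have F1_ge: "\<forall>i. 1 \<le> (v v* F1 \<sigma> \<tau>1) $ i" if "\<forall>i. 1 \<le> v $ i" for v
    using \<tau>1 that by (auto simp: \<sigma> row_times_F1 row_times_A1 row_times_perm forall_3)
  have ge: "1 \<le> triangle \<sigma> \<tau>0 \<tau>1 w $ i" for w i
    unfolding triangle_def by (rule word_mat_ge_one[OF F0_ge F1_ge]) (simp_all add: ones)

  \<comment> \<open>Read off from v A0 = (v2, v3, v1 + v3) followed by \<open>\<tau>0\<close>:
    \<open>P_13\<close> exchanges coordinates 2 and 3, \<open>P_23\<close> keeps 3, the others keep
    2.\<close>
  define K0 :: "3 set" where
    "K0 = (if \<tau>0 = P_13 then {2, 3} else if \<tau>0 = P_23 then {3} else {2})"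
  \<comment> \<open>Likewise from v A1 = (v1, v2, v1 + v3): \<open>P_12\<close> exchanges 1 and 2,
    \<open>P_23\<close> keeps 1, the others keep 2.\<close>
  define K1 :: "3 set" where
    "K1 = (if \<tau>1 = P_12 then {1, 2} else if \<tau>1 = P_23 then {1} else {2})"
  obtain i where i: "i \<in> K0" by (metis K0_def insertI1)
  obtain j where j: "j \<in> K1" by (metis K1_def insertI1)
  have "\<forall>k\<in>K0. (v v* F0 \<sigma> \<tau>0) $ k = 1" if "\<forall>k\<in>K0. v $ k = 1" for v
    using \<tau>0 that
    by (auto simp: K0_def \<sigma> row_times_F0 row_times_A0 row_times_perm split: if_splits)
  then have left: "(ones v* mat_power (F0 \<sigma> \<tau>0) n) $ i = 1"
    by (rule mat_power_fixes_ones[of K0]) (simp_all add: ones i)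
  have "\<forall>k\<in>K1. (v v* F1 \<sigma> \<tau>1) $ k = 1" if "\<forall>k\<in>K1. v $ k = 1" for v
    using \<tau>1 that
    by (auto simp: K1_def \<sigma> row_times_F1 row_times_A1 row_times_perm split: if_splits)
  then have right: "(ones v* mat_power (F1 \<sigma> \<tau>1) n) $ j = 1"
    by (rule mat_power_fixes_ones[of K1]) (simp_all add: ones j)

  \<comment> \<open>The left-most path is the word of \<open>n\<close> zeros, so it witnesses that
    the level minimum is 1, the value also found on the right-most path.\<close>
  have "triangle \<sigma> \<tau>0 \<tau>1 (replicate n 0) $ i = 1"
    using left by (simp add: triangle_def word_mat_replicate)
  then have "level_min \<sigma> \<tau>0 \<tau>1 n = 1"
    by (rule level_min_eq_one[OF ge, rotated]) (auto simp: words_def)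
  with left right show ?thesis
    by metis
qed

end
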